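(* Let $R$ be an integral domain and let $M\subset N\subset R^m$ be finitely generated submodules of a free module, having the same rank $g$. Let $I\subset R$ denote the Fitting ideal of order $m-g$ of the cokernel $R^m/M$. Then $I\subset M:N$.
   Context: $M:N=\{a\in R: aN\subset M\}$. The Fitting ideal of order $m-g$ of $R^m/M$ is the ideal generated by the $g\times g$ minors of a matrix whose columns are generators of $M$ written in the canonical basis of $R^m$. The rank of a module over the domain $R$ is the dimension of its tensor product with the fraction field of $R$. *)

theory Defs
  imports
    "HOL-Algebra.Free_Abelian_Groups"
    "HOL-Algebra.Generated_Groups"
    "HOL-Algebra.Ideal"
    "HOL-Computational_Algebra.Fraction_Field"
    "Jordan_Normal_Form.VS_Connect"
    "Jordan_Normal_Form.DL_Submatrix"
begin

section \<open>The tensor product with the fraction field\<close>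

text \<open>
  The domain \<open>R\<close> is the type \<open>'a::idom\<close>, its fraction field is \<open>'a fract\<close>, and \<open>R\<close>-modules are
  module records over \<^term>\<open>class_ring\<close>. The tensor product of the fraction field with a
  module \<open>X\<close> over \<open>R\<close> is the free abelian group on the pairs \<open>(k, x)\<close>, modulo the subgroup
  generated by the bilinearity relations, with scalars acting on the first component.
\<close>

definition tensor_generators :: "('a::idom, 'c, 'd) module_scheme \<Rightarrow> ('a fract \<times> 'c \<Rightarrow>\<^sub>0 int) monoid" where
  "tensor_generators X = free_Abelian_group (UNIV \<times> carrier X)"

definition tensor_relations :: "('a::idom, 'c, 'd) module_scheme \<Rightarrow> ('a fract \<times> 'c \<Rightarrow>\<^sub>0 int) set" where
  "tensor_relations X = generate (tensor_generators X)
     ({frag_of (k + l, x) - frag_of (k, x) - frag_of (l, x) | k l x. x \<in> carrier X}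
    \<union> {frag_of (k, x \<oplus>\<^bsub>X\<^esub> y) - frag_of (k, x) - frag_of (k, y) | k x y. x \<in> carrier X \<and> y \<in> carrier X}
    \<union> {frag_of (k * Fract r 1, x) - frag_of (k, r \<odot>\<^bsub>X\<^esub> x) | k r x. x \<in> carrier X})"

text \<open>
  In the scalar multiplication below, the sum with \<open>tensor_relations X\<close> turns the image of a coset,
  which need not be a full coset (for instance for the scalar \<open>0\<close>), into the coset containing it;
  see \<open>tensor_smult_coset\<close>. The ring-multiplication fields of the record play no role.
\<close>

definition fract_tensor ::
    "('a::idom, 'c, 'd) module_scheme \<Rightarrow> ('a fract, ('a fract \<times> 'c \<Rightarrow>\<^sub>0 int) set) module" where
  "fract_tensor X =
    \<lparr>carrier = rcosets\<^bsub>tensor_generators X\<^esub> (tensor_relations X),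
     monoid.mult = undefined,
     one = undefined,
     zero = tensor_relations X,
     add = set_mult (tensor_generators X),
     smult = (\<lambda>k C. tensor_relations X <#>\<^bsub>tensor_generators X\<^esub>
                       frag_extend (\<lambda>(l, x). frag_of (k * l, x)) ` C)\<rparr>"

definition module_rank :: "('a::idom, 'c, 'd) module_scheme \<Rightarrow> nat" where
  "module_rank X = vectorspace.dim class_ring (fract_tensor X)"


section \<open>Submodules of \<open>R\<^sup>m\<close>, colon ideals and Fitting ideals\<close>

definition fg_submodule :: "nat \<Rightarrow> 'a::idom vec set \<Rightarrow> bool" where
  "fg_submodule m M \<longleftrightarrow> LinearCombinations.submodule class_ring M (module_vec TYPE('a) m) \<and>
     (\<exists>S. finite S \<and> S \<subseteq> M \<and> LinearCombinations.module.span class_ring (module_vec TYPE('a) m) S = M)"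

definition submodule_rank :: "nat \<Rightarrow> 'a::idom vec set \<Rightarrow> nat" where
  "submodule_rank m M = module_rank ((module_vec TYPE('a) m) \<lparr>carrier := M\<rparr>)"

definition colon :: "'a::idom vec set \<Rightarrow> 'a vec set \<Rightarrow> 'a set" where
  "colon M N = {a. \<forall>x\<in>N. a \<cdot>\<^sub>v x \<in> M}"

definition minors :: "nat \<Rightarrow> 'a::idom mat \<Rightarrow> 'a set" where
  "minors k A = {det (submatrix A I J) | I J.
     I \<subseteq> {..<dim_row A} \<and> J \<subseteq> {..<dim_col A} \<and> card I = k \<and> card J = k}"

text \<open>
  \<open>is_fitting_ideal m i M I\<close>: the ideal \<open>I\<close> is the Fitting ideal of order \<open>i\<close> of \<open>R\<^sup>m/M\<close>, computed
  from some finite family of generators of \<open>M\<close>, the columns of \<open>A\<close>. As the ideal does not depend on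
  the generators, it is introduced as a relation. For \<open>i \<ge> m\<close> the only minor is the empty
  one, which is \<open>1\<close>, and \<open>I\<close> is the unit ideal, as usual.
\<close>

definition is_fitting_ideal :: "nat \<Rightarrow> nat \<Rightarrow> 'a::idom vec set \<Rightarrow> 'a set \<Rightarrow> bool" where
  "is_fitting_ideal m i M I \<longleftrightarrow> (\<exists>n. \<exists>A \<in> carrier_mat m n.
     LinearCombinations.module.span class_ring (module_vec TYPE('a) m) (set (cols A)) = M \<and>
     I = Idl\<^bsub>class_ring\<^esub> (minors (m - i) A))"


section \<open>The tensor product is a vector space\<close>

text \<open>
  Since \<^const>\<open>vectorspace.dim\<close> is a total function, \<^const>\<open>module_rank\<close> is meaningful only
  because of the following facts.
\<close>

context
  fixes X :: "('a::idom, 'c, 'd) module_scheme"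
  assumes X: "Module.module class_ring X"
begin

interpretation X: Module.module class_ring X by (rule X)

private abbreviation "F \<equiv> tensor_generators X"
private abbreviation "T \<equiv> tensor_relations X"
private abbreviation act :: "'a fract \<Rightarrow> ('a fract \<times> 'c \<Rightarrow>\<^sub>0 int) \<Rightarrow> ('a fract \<times> 'c \<Rightarrow>\<^sub>0 int)" where
  "act k \<equiv> frag_extend (\<lambda>(l, x). frag_of (k * l, x))"

interpretation F: comm_group F
  unfolding tensor_generators_def by (rule abelian_free_Abelian_group)

private lemma F_simps [simp]:
  "c \<in> carrier F \<longleftrightarrow> Poly_Mapping.keys c \<subseteq> UNIV \<times> carrier X"
  "c \<otimes>\<^bsub>F\<^esub> d = c + d" "\<one>\<^bsub>F\<^esub> = 0"
  by (simp_all add: tensor_generators_def)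

private lemma F_inv: "c \<in> carrier F \<Longrightarrow> inv\<^bsub>F\<^esub> c = - c"
  by (simp add: tensor_generators_def)

private lemma F_diff: "c \<in> carrier F \<Longrightarrow> d \<in> carrier F \<Longrightarrow> c - d \<in> carrier F"
  using keys_diff[of c d] by fastforce

private lemma F_frag_of: "x \<in> carrier X \<Longrightarrow> frag_of (k, x) \<in> carrier F"
  by simp

private definition rels :: "('a fract \<times> 'c \<Rightarrow>\<^sub>0 int) set" where
  "rels = {frag_of (k + l, x) - frag_of (k, x) - frag_of (l, x) | k l x. x \<in> carrier X}
    \<union> {frag_of (k, x \<oplus>\<^bsub>X\<^esub> y) - frag_of (k, x) - frag_of (k, y) | k x y. x \<in> carrier X \<and> y \<in> carrier X}
    \<union> {frag_of (k * Fract r 1, x) - frag_of (k, r \<odot>\<^bsub>X\<^esub> x) | k r x. x \<in> carrier X}"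

private lemma T_eq: "T = generate F rels"
  by (simp add: tensor_relations_def rels_def)

private lemma rels_F: "rels \<subseteq> carrier F"
proof -
  have smult: "r \<odot>\<^bsub>X\<^esub> x \<in> carrier X" if "x \<in> carrier X" for r x
    using X.smult_closed[of r x] that by simp
  show ?thesis
    unfolding rels_def
    by (auto simp del: F_simps(1) intro!: F_diff F_frag_of smult X.add.m_closed)
qed

private lemma T_subgroup: "subgroup T F"
  unfolding T_eq by (rule F.generate_is_subgroup[OF rels_F])

interpretation T: normal T F
  by (rule F.normal_iff_subgroup[THEN iffD2, OF T_subgroup])

private lemma T_F: "t \<in> T \<Longrightarrow> t \<in> carrier F"
  by (rule T.mem_carrier)

private lemma T_add: "s \<in> T \<Longrightarrow> t \<in> T \<Longrightarrow> s + t \<in> T"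
  using T.m_closed[of s t] by simp

private lemma T_uminus: "t \<in> T \<Longrightarrow> - t \<in> T"
  using T.m_inv_closed[of t] F_inv[OF T_F] by simp

private lemma T_zero: "0 \<in> T"
  using T.one_closed by simp

private lemma act_F: "c \<in> carrier F \<Longrightarrow> act k c \<in> carrier F"
  using keys_frag_extend[of "\<lambda>(l, x). frag_of (k * l, x)" c] by (fastforce split: if_splits)

private lemma act_rels: "c \<in> rels \<Longrightarrow> act k c \<in> rels"
  unfolding rels_def
  by (auto simp: frag_extend_diff distrib_left mult.assoc[symmetric])

private lemma act_T: "c \<in> T \<Longrightarrow> act k c \<in> T"
  unfolding T_eq
proof (induction rule: generate.induct)
  case one
  then show ?case using T_zero by (simp add: T_eq)
next
  case (incl h)
  then show ?case by (intro generate.incl act_rels)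
next
  case (inv h)
  then show ?case
    using T_uminus[of "act k h"] act_rels[OF inv, THEN generate.incl[of _ _ F]] rels_F
    by (auto simp: F_inv[OF subsetD] frag_extend_minus T_eq simp del: F_simps(1))
next
  case (eng h1 h2)
  then show ?case using T_add by (simp add: frag_extend_add T_eq)
qed

private lemma coset_eqI:
  assumes c: "c \<in> carrier F" and d: "d \<in> carrier F" and "c - d \<in> T"
  shows "T #>\<^bsub>F\<^esub> c = T #>\<^bsub>F\<^esub> d"
proof (rule F.repr_independence[OF _ c T_subgroup])
  have "d - c \<in> T" using T_uminus[OF assms(3)] by simp
  moreover have "d = (d - c) \<otimes>\<^bsub>F\<^esub> c" by simp
  ultimately show "d \<in> T #>\<^bsub>F\<^esub> c" unfolding r_coset_def by blast
qed

lemma tensor_smult_coset: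
  assumes "c \<in> carrier F"
  shows "k \<odot>\<^bsub>fract_tensor X\<^esub> (T #>\<^bsub>F\<^esub> c) = T #>\<^bsub>F\<^esub> act k c"
proof -
  have "T <#>\<^bsub>F\<^esub> act k ` (T #>\<^bsub>F\<^esub> c) = T #>\<^bsub>F\<^esub> act k c"
  proof (intro equalityI subsetI)
    fix z assume "z \<in> T <#>\<^bsub>F\<^esub> act k ` (T #>\<^bsub>F\<^esub> c)"
    then obtain s t where st: "s \<in> T" "t \<in> T" and z: "z = s + act k (t + c)"
      by (auto simp: set_mult_def r_coset_def)
    then have "z = (s + act k t) + act k c" by (simp add: frag_extend_add add.assoc)
    then show "z \<in> T #>\<^bsub>F\<^esub> act k c"
      using st act_T T_add by (auto simp: r_coset_def)
  next
    fix z assume "z \<in> T #>\<^bsub>F\<^esub> act k c"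
    then obtain s where "s \<in> T" "z = s + act k (0 + c)" by (auto simp: r_coset_def)
    then show "z \<in> T <#>\<^bsub>F\<^esub> act k ` (T #>\<^bsub>F\<^esub> c)"
      using T_zero by (force simp: set_mult_def r_coset_def)
  qed
  then show ?thesis by (simp add: fract_tensor_def)
qed

lemma tensor_add_coset:
  assumes "c \<in> carrier F" "d \<in> carrier F"
  shows "(T #>\<^bsub>F\<^esub> c) \<oplus>\<^bsub>fract_tensor X\<^esub> (T #>\<^bsub>F\<^esub> d) = T #>\<^bsub>F\<^esub> (c + d)"
  using T.rcos_sum[OF assms] by (simp add: fract_tensor_def)

private lemma act_plus:
  assumes "c \<in> carrier F"
  shows "act (k + l) c - (act k c + act l c) \<in> T"
proof -
  have "Poly_Mapping.keys c \<subseteq> UNIV \<times> carrier X" using assms by simp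
  then show ?thesis
  proof (induction rule: frag_induction)
    case zero
    then show ?case by (simp add: T_zero)
  next
    case (one p)
    obtain j x where p: "p = (j, x)" by (cases p)
    then have "x \<in> carrier X" using one by auto
    then have "frag_of (k * j + l * j, x) - frag_of (k * j, x) - frag_of (l * j, x) \<in> rels"
      unfolding rels_def by blast
    then show ?case
      unfolding T_eq by (intro generate.incl) (simp add: p distrib_right diff_diff_eq)
  next
    case (diff a b)
    then show ?case
      using T_add[OF diff(1) T_uminus[OF diff(2)]]
      by (simp add: frag_extend_diff algebra_simps)
  qed
qed

private lemma act_act: "act k (act l c) = act (k * l) c"
proof -
  have "Poly_Mapping.keys c \<subseteq> UNIV" by simp
  then show ?thesis
    by (induction rule: frag_induction) (auto simp: frag_extend_diff mult.assoc)
qed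

private lemma act_one: "act 1 c = c"
proof -
  have "Poly_Mapping.keys c \<subseteq> UNIV" by simp
  then show ?thesis
    by (induction rule: frag_induction) (auto simp: frag_extend_diff)
qed

private lemma tensor_cases:
  assumes "C \<in> carrier (fract_tensor X)"
  obtains c where "c \<in> carrier F" "C = T #>\<^bsub>F\<^esub> c"
  using assms by (auto simp: fract_tensor_def RCOSETS_def)

private lemma coset_in: "c \<in> carrier F \<Longrightarrow> T #>\<^bsub>F\<^esub> c \<in> carrier (fract_tensor X)"
  by (auto simp: fract_tensor_def RCOSETS_def)

lemma fract_tensor_vectorspace: "vectorspace class_ring (fract_tensor X)"
proof -
  interpret Q: comm_group "F Mod T"
    by (rule F.abelian_FactGroup[OF T_subgroup])
  have Q: "carrier (fract_tensor X) = carrier (F Mod T)" "add (fract_tensor X) = monoid.mult (F Mod T)"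
    "\<zero>\<^bsub>fract_tensor X\<^esub> = \<one>\<^bsub>F Mod T\<^esub>"
    by (simp_all add: fract_tensor_def FactGroup_def)
  have ab: "abelian_group (fract_tensor X)"
  proof (rule abelian_groupI, unfold Q, goal_cases)
    case (1 x y) then show ?case by (rule Q.m_closed)
  next
    case 2 show ?case by (rule Q.one_closed)
  next
    case (3 x y z) then show ?case by (rule Q.m_assoc)
  next
    case (4 x y) then show ?case by (rule Q.m_comm)
  next
    case (5 x) then show ?case by (rule Q.l_one)
  next
    case (6 x) then show ?case using Q.l_inv[of x] Q.inv_closed[of x] by blast
  qed
  have F_add: "c + d \<in> carrier F" if "c \<in> carrier F" "d \<in> carrier F" for c d
    using F.m_closed[OF that] by simp
  have "Module.module (class_ring :: 'a fract ring) (fract_tensor X)"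
  proof (rule moduleI[OF class_cring.cring_axioms ab], goal_cases)
    case (1 a x)
    then show ?case by (auto elim!: tensor_cases simp: tensor_smult_coset coset_in act_F simp del: F_simps(1))
  next
    case (2 a b x)
    then obtain c where c: "c \<in> carrier F" and x: "x = T #>\<^bsub>F\<^esub> c" by (elim tensor_cases)
    have "T #>\<^bsub>F\<^esub> act (a + b) c = T #>\<^bsub>F\<^esub> (act a c + act b c)"
      by (intro coset_eqI act_plus F_add act_F c)
    then show ?case
      using c by (simp add: x tensor_smult_coset tensor_add_coset act_F del: F_simps(1))
  next
    case (3 a x y)
    then show ?case
      by (auto elim!: tensor_cases simp: tensor_smult_coset tensor_add_coset act_F F_add
          frag_extend_add simp del: F_simps(1))
  next
    case (4 a b x)
    then show ?case
      by (auto elim!: tensor_cases simp: tensor_smult_coset act_F act_act simp del: F_simps(1))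
  next
    case (5 x)
    then obtain c where c: "c \<in> carrier F" and x: "x = T #>\<^bsub>F\<^esub> c" by (elim tensor_cases)
    show ?case
      using tensor_smult_coset[OF c, of 1] unfolding act_one x by simp
  qed
  then show ?thesis
    by (simp add: vectorspace_def class_field)
qed

end

end

theory Submission
  imports Defs
begin

text \<open>
  Let \<open>K\<close> be the fraction field of the domain \<open>R\<close>. Because \<open>N\<close> has rank \<open>g\<close>, a generating set of
  \<open>g\<close> elements of \<open>K \<otimes> N\<close> maps to \<open>g\<close> vectors in \<open>K\<^sup>m\<close> whose \<open>K\<close>-span contains \<open>N\<close>. With these
  vectors as the columns of an \<open>m \<times> g\<close> matrix \<open>P\<close>, every \<open>x \<in> N\<close> has the form \<open>P w\<close> with
  \<open>w \<in> K\<^sup>g\<close> (\<open>rank_factorization\<close>).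

  As \<open>M : N\<close> is an ideal, it is enough to multiply \<open>N\<close> into \<open>M\<close> by a single minor
  \<open>\<delta> = det B \<noteq> 0\<close>, where \<open>B\<close> consists of the rows \<open>r\<close> of \<open>g\<close> generators of \<open>M\<close>, the columns of
  a matrix \<open>C\<close>. These generators lie in \<open>N\<close>, so \<open>C = P W\<close> for a square matrix \<open>W\<close>, and \<open>B = Q W\<close>
  where \<open>Q\<close> consists of the rows \<open>r\<close> of \<open>P\<close>. Now \<open>Q (W adj B) = B adj B = \<delta> 1\<close>, and square matrices
  over a field that are inverse to each other on one side are so on both sides, hence
  \<open>W adj B Q = \<delta> 1\<close>. For \<open>x = P w \<in> N\<close> with rows \<open>x\<^sub>r = Q w\<close> this gives Cramer's rule
  \<open>C (adj B x\<^sub>r) = P (W adj B Q) w = \<delta> x\<close>. The left-hand side is an \<open>R\<close>-linear combination of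
  columns of \<open>C\<close>, so \<open>\<delta> x \<in> M\<close> (\<open>minor_smult_eq_column_combination\<close>, \<open>minor_mem_colon\<close>).

  The passage from \<open>K \<otimes> N\<close> to \<open>K\<^sup>m\<close> uses the universal property of the tensor product, one
  coordinate at a time (\<open>fract_tensor_functional\<close>). The \<open>g\<close> generators exist because \<open>K \<otimes> N\<close> is
  finite-dimensional (\<open>fract_tensor_fin_dim\<close>).
\<close>

section \<open>Homomorphisms out of a free abelian group\<close>

text \<open>
  The homomorphism from the free abelian group to the additive group of a ring that extends \<open>f\<close>;
  unlike \<^const>\<open>frag_extend\<close>, its values need not be formal sums.
\<close>

definition frag_sum :: "('b \<Rightarrow> 'k::ring_1) \<Rightarrow> ('b \<Rightarrow>\<^sub>0 int) \<Rightarrow> 'k" where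
  "frag_sum f c = (\<Sum>p\<in>Poly_Mapping.keys c. of_int (Poly_Mapping.lookup c p) * f p)"

lemma frag_sum_superset:
  assumes "finite A" "Poly_Mapping.keys c \<subseteq> A"
  shows "frag_sum f c = (\<Sum>p\<in>A. of_int (Poly_Mapping.lookup c p) * f p)"
  unfolding frag_sum_def
  by (rule sum.mono_neutral_left) (use assms in \<open>auto simp: in_keys_iff\<close>)

lemma frag_sum_zero [simp]: "frag_sum f 0 = 0"
  by (simp add: frag_sum_def)

lemma frag_sum_frag_of [simp]: "frag_sum f (frag_of p) = f p"
  by (simp add: frag_sum_def)

lemma frag_sum_diff: "frag_sum f (c - d) = frag_sum f c - frag_sum f d"
proof -
  let ?A = "Poly_Mapping.keys c \<union> Poly_Mapping.keys d"
  show ?thesis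
    using keys_diff[of c d]
    by (simp add: frag_sum_superset[of ?A] lookup_minus left_diff_distrib sum_subtractf)
qed

lemma frag_sum_uminus: "frag_sum f (- c) = - frag_sum f c"
  using frag_sum_diff[of f 0 c] by simp

lemma frag_sum_add: "frag_sum f (c + d) = frag_sum f c + frag_sum f d"
  using frag_sum_diff[of f c "- d"] by (simp add: frag_sum_uminus)

lemma frag_sum_frag_extend:
  "frag_sum f (frag_extend h c) = frag_sum (\<lambda>p. frag_sum f (h p)) c"
proof -
  have "Poly_Mapping.keys c \<subseteq> UNIV" by simp
  then show ?thesis
    by (induction rule: frag_induction) (auto simp: frag_extend_diff frag_sum_diff)
qed

lemma frag_sum_mult_left: "frag_sum (\<lambda>p. k * f p) c = k * frag_sum f (c :: _ \<Rightarrow>\<^sub>0 int)"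
  for k :: "'k :: comm_ring_1"
  by (simp add: frag_sum_def sum_distrib_left ac_simps)

section \<open>Scalar extension to the fraction field\<close>

definition pure_tensor :: "('a::idom, 'c, 'd) module_scheme \<Rightarrow> 'a fract \<Rightarrow> 'c \<Rightarrow> ('a fract \<times> 'c \<Rightarrow>\<^sub>0 int) set" where
  "pure_tensor X k x = tensor_relations X #>\<^bsub>tensor_generators X\<^esub> frag_of (k, x)"

context
  fixes X :: "('a::idom, 'c, 'd) module_scheme"
  assumes X: "Module.module class_ring X"
begin

interpretation X: Module.module class_ring X by (rule X)

interpretation V: vectorspace class_ring "fract_tensor X"
  by (rule fract_tensor_vectorspace[OF X])

private abbreviation "F \<equiv> tensor_generators X"
private abbreviation "T \<equiv> tensor_relations X"

interpretation F: comm_group F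
  unfolding tensor_generators_def by (rule abelian_free_Abelian_group)

text \<open>
  The relations are named to allow inductions over \<^const>\<open>tensor_relations\<close>, the subgroup that
  they generate.
\<close>

private definition rels :: "('a fract \<times> 'c \<Rightarrow>\<^sub>0 int) set" where
  "rels = {frag_of (k + l, x) - frag_of (k, x) - frag_of (l, x) | k l x. x \<in> carrier X}
    \<union> {frag_of (k, x \<oplus>\<^bsub>X\<^esub> y) - frag_of (k, x) - frag_of (k, y) | k x y. x \<in> carrier X \<and> y \<in> carrier X}
    \<union> {frag_of (k * Fract r 1, x) - frag_of (k, r \<odot>\<^bsub>X\<^esub> x) | k r x. x \<in> carrier X}"

private lemma T_eq: "T = generate F rels"
  by (simp add: tensor_relations_def rels_def)

private lemma F_iff: "c \<in> carrier F \<longleftrightarrow> Poly_Mapping.keys c \<subseteq> UNIV \<times> carrier X"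
  by (simp add: tensor_generators_def)

private lemma F_ops [simp]: "c \<otimes>\<^bsub>F\<^esub> d = c + d" "\<one>\<^bsub>F\<^esub> = 0"
  by (simp_all add: tensor_generators_def)

private lemma F_inv: "c \<in> carrier F \<Longrightarrow> inv\<^bsub>F\<^esub> c = - c"
  by (simp add: tensor_generators_def)

private lemma F_add: "c \<in> carrier F \<Longrightarrow> d \<in> carrier F \<Longrightarrow> c + d \<in> carrier F"
  using F.m_closed[of c d] by simp

private lemma F_diff: "c \<in> carrier F \<Longrightarrow> d \<in> carrier F \<Longrightarrow> c - d \<in> carrier F"
  using F.m_closed[OF _ F.inv_closed, of c d] by (simp add: F_inv)

private lemma F_frag_of: "x \<in> carrier X \<Longrightarrow> frag_of (k, x) \<in> carrier F"
  by (simp add: F_iff)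

private lemma smult_X: "x \<in> carrier X \<Longrightarrow> r \<odot>\<^bsub>X\<^esub> x \<in> carrier X"
  using X.smult_closed[of r x] by simp

private lemma rels_F: "rels \<subseteq> carrier F"
  unfolding rels_def by (auto intro!: F_diff F_frag_of smult_X X.add.m_closed)

private lemma T_subgroup: "subgroup T F"
  unfolding T_eq by (rule F.generate_is_subgroup[OF rels_F])

private lemma coset_eqI:
  assumes c: "c \<in> carrier F" and d: "d \<in> carrier F" and "d - c \<in> T"
  shows "T #>\<^bsub>F\<^esub> c = T #>\<^bsub>F\<^esub> d"
proof (rule F.repr_independence[OF _ c T_subgroup])
  have "d = (d - c) \<otimes>\<^bsub>F\<^esub> c" by simp
  then show "d \<in> T #>\<^bsub>F\<^esub> c" using assms(3) unfolding r_coset_def by blast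
qed

private lemma coset_closed: "c \<in> carrier F \<Longrightarrow> T #>\<^bsub>F\<^esub> c \<in> carrier (fract_tensor X)"
  by (auto simp: fract_tensor_def RCOSETS_def)

private lemma tensor_cases:
  assumes "C \<in> carrier (fract_tensor X)"
  obtains c where "c \<in> carrier F" "C = T #>\<^bsub>F\<^esub> c"
  using assms by (auto simp: fract_tensor_def RCOSETS_def)

lemma pure_tensor_closed: "x \<in> carrier X \<Longrightarrow> pure_tensor X k x \<in> carrier (fract_tensor X)"
  unfolding pure_tensor_def by (intro coset_closed F_frag_of)

lemma pure_tensor_add:
  assumes "x \<in> carrier X" "y \<in> carrier X"
  shows "pure_tensor X k (x \<oplus>\<^bsub>X\<^esub> y) = pure_tensor X k x \<oplus>\<^bsub>fract_tensor X\<^esub> pure_tensor X k y"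
proof -
  have "frag_of (k, x \<oplus>\<^bsub>X\<^esub> y) - frag_of (k, x) - frag_of (k, y) \<in> rels"
    using assms unfolding rels_def by blast
  then have "frag_of (k, x \<oplus>\<^bsub>X\<^esub> y) - (frag_of (k, x) + frag_of (k, y)) \<in> T"
    unfolding T_eq diff_diff_eq by (rule generate.incl)
  then have "T #>\<^bsub>F\<^esub> (frag_of (k, x) + frag_of (k, y)) = T #>\<^bsub>F\<^esub> frag_of (k, x \<oplus>\<^bsub>X\<^esub> y)"
    using assms by (intro coset_eqI F_add F_frag_of X.add.m_closed)
  then show ?thesis
    unfolding pure_tensor_def using assms by (simp add: tensor_add_coset[OF X] F_frag_of)
qed

lemma pure_tensor_smult_right:
  assumes "x \<in> carrier X"
  shows "pure_tensor X k (r \<odot>\<^bsub>X\<^esub> x) = pure_tensor X (k * Fract r 1) x"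
proof -
  have "frag_of (k * Fract r 1, x) - frag_of (k, r \<odot>\<^bsub>X\<^esub> x) \<in> rels"
    using assms unfolding rels_def by blast
  then show ?thesis
    unfolding pure_tensor_def using assms
    by (intro coset_eqI F_frag_of smult_X) (auto simp: T_eq intro: generate.incl)
qed

lemma pure_tensor_smult_left:
  assumes "x \<in> carrier X"
  shows "l \<odot>\<^bsub>fract_tensor X\<^esub> pure_tensor X k x = pure_tensor X (l * k) x"
  unfolding pure_tensor_def using assms by (simp add: tensor_smult_coset[OF X] F_frag_of)

text \<open>
  A formal sum is built from single pairs by subtraction, and in the tensor product subtraction is
  addition of a \<open>(-1)\<close>-multiple, under which a submodule is closed.
\<close>

lemma pure_tensors_generate:
  assumes U: "LinearCombinations.submodule class_ring U (fract_tensor X)"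
    and pure: "\<And>k x. x \<in> carrier X \<Longrightarrow> pure_tensor X k x \<in> U"
  shows "carrier (fract_tensor X) \<subseteq> U"
proof
  interpret U: LinearCombinations.submodule class_ring U "fract_tensor X" by (rule U)
  fix C assume "C \<in> carrier (fract_tensor X)"
  then obtain c where c: "c \<in> carrier F" and C: "C = T #>\<^bsub>F\<^esub> c" by (rule tensor_cases)
  have "Poly_Mapping.keys c \<subseteq> UNIV \<times> carrier X" using c by (simp add: F_iff)
  then have "T #>\<^bsub>F\<^esub> c \<in> U"
  proof (rule free_Abelian_group_induct[where P = "\<lambda>c. T #>\<^bsub>F\<^esub> c \<in> U"], goal_cases)
    case 1
    have "\<zero>\<^bsub>fract_tensor X\<^esub> = T #>\<^bsub>F\<^esub> 0"
      using F.coset_mult_one[of T] subgroup.subset[OF T_subgroup] by (simp add: fract_tensor_def)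
    then show ?case using U.zero_closed by simp
  next
    case (2 a b)
    then have ab: "a \<in> carrier F" "b \<in> carrier F" by (simp_all add: F_iff)
    have "(T #>\<^bsub>F\<^esub> (a - b)) \<oplus>\<^bsub>fract_tensor X\<^esub> (T #>\<^bsub>F\<^esub> b) = T #>\<^bsub>F\<^esub> a"
      using ab by (simp add: tensor_add_coset[OF X] F_diff)
    then have "T #>\<^bsub>F\<^esub> (a - b) = (T #>\<^bsub>F\<^esub> a) \<oplus>\<^bsub>fract_tensor X\<^esub> (\<ominus>\<^bsub>fract_tensor X\<^esub> (T #>\<^bsub>F\<^esub> b))"
      using V.M.add.inv_solve_right[of "T #>\<^bsub>F\<^esub> (a - b)" "T #>\<^bsub>F\<^esub> a" "T #>\<^bsub>F\<^esub> b"] ab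
      by (simp add: coset_closed F_diff)
    moreover have "\<ominus>\<^bsub>fract_tensor X\<^esub> (T #>\<^bsub>F\<^esub> b) \<in> U"
      using V.smult_minus_1[of "T #>\<^bsub>F\<^esub> b"] 2(4) ab U.smult_closed[of "-1" "T #>\<^bsub>F\<^esub> b"]
      by (simp add: coset_closed class_ring_simps)
    ultimately show ?case using 2(3) U.m_closed by simp
  next
    case (3 a)
    then show ?case using pure unfolding pure_tensor_def by (cases a) auto
  qed
  then show "C \<in> U" by (simp add: C)
qed

text \<open>
  If \<open>S\<close> generates \<open>X\<close>, the tensors \<open>1 \<otimes> s\<close> span: the elements \<open>x\<close> for which all \<open>k \<otimes> x\<close> lie
  in their span form a submodule of \<open>X\<close> that contains \<open>S\<close>.
\<close>

lemma fract_tensor_fin_dim: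
  assumes S: "finite S" "S \<subseteq> carrier X" and span: "X.span S = carrier X"
  shows "V.fin_dim"
proof -
  let ?G = "pure_tensor X 1 ` S"
  have G: "?G \<subseteq> carrier (fract_tensor X)" using S pure_tensor_closed by blast
  have span_G: "LinearCombinations.submodule class_ring (V.span ?G) (fract_tensor X)"
    by (rule V.span_is_submodule[OF G])
  interpret U: LinearCombinations.submodule class_ring "V.span ?G" "fract_tensor X"
    by (rule span_G)
  define Y where "Y = {x \<in> carrier X. \<forall>k. pure_tensor X k x \<in> V.span ?G}"
  have zero: "pure_tensor X k \<zero>\<^bsub>X\<^esub> \<in> V.span ?G" for k
  proof -
    have "pure_tensor X k \<zero>\<^bsub>X\<^esub> = pure_tensor X (0 * k) \<zero>\<^bsub>X\<^esub>"
      using pure_tensor_smult_right[of "\<zero>\<^bsub>X\<^esub>" k 0] X.smult_r_null[of 0]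
      by (simp add: Zero_fract_def[symmetric])
    also have "\<dots> = 0 \<odot>\<^bsub>fract_tensor X\<^esub> pure_tensor X k \<zero>\<^bsub>X\<^esub>"
      by (simp add: pure_tensor_smult_left)
    also have "\<dots> = \<zero>\<^bsub>fract_tensor X\<^esub>"
      using V.smult_l_null[of "pure_tensor X k \<zero>\<^bsub>X\<^esub>"] by (simp add: pure_tensor_closed)
    finally show ?thesis using U.zero_closed by simp
  qed
  have "LinearCombinations.submodule class_ring Y X"
    by unfold_locales
      (auto simp: Y_def zero pure_tensor_add pure_tensor_smult_right smult_X)
  moreover have "S \<subseteq> Y"
  proof
    fix s assume s: "s \<in> S"
    then have "pure_tensor X 1 s \<in> V.span ?G" using V.in_own_span[OF G] by blast
    then have "pure_tensor X k s \<in> V.span ?G" for k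
      using U.smult_closed[of k "pure_tensor X 1 s"] pure_tensor_smult_left[of s k 1] s S(2)
      by (simp add: subsetD)
    then show "s \<in> Y" using s S by (auto simp: Y_def)
  qed
  ultimately have "carrier X \<subseteq> Y" using X.span_is_subset[of S Y] span by simp
  then have "carrier (fract_tensor X) \<subseteq> V.span ?G"
    by (intro pure_tensors_generate[OF span_G]) (auto simp: Y_def)
  then show ?thesis
    unfolding V.fin_dim_def using S(1) G V.span_is_subset2[OF G] by blast
qed

text \<open>
  The universal property: an \<open>R\<close>-linear map \<open>f\<close> from \<open>X\<close> to the fraction field extends to a linear
  functional on the tensor product. The extension of \<open>(k, x) \<mapsto> k f(x)\<close> to formal sums vanishes on
  the relations, so it is constant on cosets and may be evaluated at any representative.
\<close>

lemma fract_tensor_functional: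
  fixes f :: "'c \<Rightarrow> 'a fract"
  assumes add: "\<And>x y. x \<in> carrier X \<Longrightarrow> y \<in> carrier X \<Longrightarrow> f (x \<oplus>\<^bsub>X\<^esub> y) = f x + f y"
    and smult: "\<And>r x. x \<in> carrier X \<Longrightarrow> f (r \<odot>\<^bsub>X\<^esub> x) = Fract r 1 * f x"
  obtains h where
    "\<And>C D. C \<in> carrier (fract_tensor X) \<Longrightarrow> D \<in> carrier (fract_tensor X) \<Longrightarrow>
       h (C \<oplus>\<^bsub>fract_tensor X\<^esub> D) = h C + h D"
    "\<And>k C. C \<in> carrier (fract_tensor X) \<Longrightarrow> h (k \<odot>\<^bsub>fract_tensor X\<^esub> C) = k * h C"
    "\<And>x. x \<in> carrier X \<Longrightarrow> h (pure_tensor X 1 x) = f x"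
proof -
  define e where "e = frag_sum (\<lambda>(k, x). k * f x)"
  have e_T: "e t = 0" if "t \<in> T" for t
    using that unfolding T_eq
  proof (induction rule: generate.induct)
    case one
    then show ?case by (simp add: e_def)
  next
    case (incl t)
    then show ?case
      by (auto simp: rels_def e_def frag_sum_diff add smult distrib_left distrib_right mult.assoc)
  next
    case (inv t)
    then have "e t = 0"
      by (auto simp: rels_def e_def frag_sum_diff add smult distrib_left distrib_right mult.assoc)
    then show ?case using inv rels_F by (simp add: F_inv subsetD e_def frag_sum_uminus)
  next
    case (eng s t)
    then show ?case by (simp add: e_def frag_sum_add)
  qed
  define h where "h C = e (SOME c. c \<in> C)" for C
  have h: "h (T #>\<^bsub>F\<^esub> c) = e c" if c: "c \<in> carrier F" for c
  proof -
    have "(SOME d. d \<in> T #>\<^bsub>F\<^esub> c) \<in> T #>\<^bsub>F\<^esub> c"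
      using F.rcos_self[OF c T_subgroup] by (rule someI)
    then obtain t where "t \<in> T" "(SOME d. d \<in> T #>\<^bsub>F\<^esub> c) = t + c"
      by (auto simp: r_coset_def)
    then show ?thesis using e_T by (simp add: h_def e_def frag_sum_add)
  qed
  have act: "frag_extend (\<lambda>(l, x). frag_of (k * l, x)) c \<in> carrier F" if "c \<in> carrier F" for k c
    using that keys_frag_extend[of "\<lambda>(l, x). frag_of (k * l, x)" c]
    by (fastforce simp: F_iff split: if_splits)
  have e_act: "e (frag_extend (\<lambda>(l, x). frag_of (k * l, x)) c) = k * e c" for k c
    unfolding e_def frag_sum_frag_extend frag_sum_mult_left[symmetric]
    by (intro arg_cong2[where f = frag_sum]) (auto simp: mult.assoc)
  show thesis
  proof (rule that[of h])
    fix C D assume "C \<in> carrier (fract_tensor X)" "D \<in> carrier (fract_tensor X)"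
    then show "h (C \<oplus>\<^bsub>fract_tensor X\<^esub> D) = h C + h D"
      by (auto elim!: tensor_cases simp: tensor_add_coset[OF X] h F_add)
        (simp add: e_def frag_sum_add)
  next
    fix k C assume "C \<in> carrier (fract_tensor X)"
    then show "h (k \<odot>\<^bsub>fract_tensor X\<^esub> C) = k * h C"
      by (auto elim!: tensor_cases simp: tensor_smult_coset[OF X] h act e_act)
  next
    fix x assume "x \<in> carrier X"
    then show "h (pure_tensor X 1 x) = f x"
      by (simp add: pure_tensor_def h F_frag_of) (simp add: e_def)
  qed
qed

text \<open>
  Any family of \<open>R\<close>-linear maps from \<open>X\<close> to the fraction field factors through a space of dimension
  \<^term>\<open>module_rank X\<close>: the maps extend to the tensor product, where each of them is determined by
  its values on a generating set of that size, and \<open>w\<close> contains coefficients of \<open>1 \<otimes> x\<close> with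
  respect to this set.
\<close>

lemma functionals_factor_through_rank:
  fixes f :: "'i \<Rightarrow> 'c \<Rightarrow> 'a fract"
  assumes S: "finite S" "S \<subseteq> carrier X" and span: "X.span S = carrier X"
    and add: "\<And>i x y. x \<in> carrier X \<Longrightarrow> y \<in> carrier X \<Longrightarrow> f i (x \<oplus>\<^bsub>X\<^esub> y) = f i x + f i y"
    and smult: "\<And>i r x. x \<in> carrier X \<Longrightarrow> f i (r \<odot>\<^bsub>X\<^esub> x) = Fract r 1 * f i x"
  obtains p :: "'i \<Rightarrow> nat \<Rightarrow> 'a fract" where
    "\<And>x. x \<in> carrier X \<Longrightarrow> \<exists>w. \<forall>i. f i x = (\<Sum>j<module_rank X. p i j * w j)"
proof -
  let ?V = "fract_tensor X"
  have "\<exists>h. (\<forall>C\<in>carrier ?V. \<forall>D\<in>carrier ?V. h (C \<oplus>\<^bsub>?V\<^esub> D) = h C + h D) \<and>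
      (\<forall>k. \<forall>C\<in>carrier ?V. h (k \<odot>\<^bsub>?V\<^esub> C) = k * h C) \<and> (\<forall>x\<in>carrier X. h (pure_tensor X 1 x) = f i x)" for i
    by (rule fract_tensor_functional[of "f i"]) (use add smult in blast)+
  then obtain h where
    h_add: "\<And>i C D. C \<in> carrier ?V \<Longrightarrow> D \<in> carrier ?V \<Longrightarrow> h i (C \<oplus>\<^bsub>?V\<^esub> D) = h i C + h i D" and
    h_smult: "\<And>i k C. C \<in> carrier ?V \<Longrightarrow> h i (k \<odot>\<^bsub>?V\<^esub> C) = k * h i C" and
    h_pure: "\<And>i x. x \<in> carrier X \<Longrightarrow> h i (pure_tensor X 1 x) = f i x"
    by metis
  have h_zero: "h i \<zero>\<^bsub>?V\<^esub> = 0" for i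
    using h_add[OF V.M.zero_closed V.M.zero_closed, of i]
    unfolding V.M.l_zero[OF V.M.zero_closed] by (metis add_cancel_right_right)
  \<comment> \<open>The dimension is a least cardinality, which is attained because there is a finite generating set.\<close>
  have "\<exists>n A. finite A \<and> card A = n \<and> A \<subseteq> carrier ?V \<and> V.span A = carrier ?V"
    using fract_tensor_fin_dim[OF S span] unfolding V.fin_dim_def by blast
  then have "\<exists>A. finite A \<and> card A = V.dim \<and> A \<subseteq> carrier ?V \<and> V.span A = carrier ?V"
    unfolding V.dim_def by (rule LeastI_ex)
  then obtain A where A: "finite A" "card A = module_rank X" "A \<subseteq> carrier ?V" "V.span A = carrier ?V"
    unfolding module_rank_def by blast
  obtain b where b: "bij_betw b {..<module_rank X} A"
    using ex_bij_betw_nat_finite[OF A(1)] by (auto simp: A(2) atLeast0LessThan)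
  \<comment> \<open>The tensors that admit coefficients form a submodule, so it suffices to find them on \<open>A\<close>.\<close>
  define U where "U = {C \<in> carrier ?V. \<exists>w. \<forall>i. h i C = (\<Sum>j<module_rank X. h i (b j) * w j)}"
  have "LinearCombinations.submodule class_ring U ?V"
  proof (unfold_locales, goal_cases)
    case 1
    then show ?case by (auto simp: U_def)
  next
    case (2 C D)
    then obtain v w where
      "\<forall>i. h i C = (\<Sum>j<module_rank X. h i (b j) * v j)"
      "\<forall>i. h i D = (\<Sum>j<module_rank X. h i (b j) * w j)" by (auto simp: U_def)
    then have "\<forall>i. h i (C \<oplus>\<^bsub>?V\<^esub> D) = (\<Sum>j<module_rank X. h i (b j) * (v j + w j))"
      using 2 by (simp add: U_def h_add distrib_left sum.distrib)
    then show ?case using 2 unfolding U_def by (auto intro!: exI[of _ "\<lambda>j. v j + w j"])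
  next
    case 3
    show ?case by (auto simp: U_def h_zero intro!: exI[of _ "\<lambda>j. 0"])
  next
    case (4 k C)
    then obtain v where "\<forall>i. h i C = (\<Sum>j<module_rank X. h i (b j) * v j)" by (auto simp: U_def)
    then have "\<forall>i. h i (k \<odot>\<^bsub>?V\<^esub> C) = (\<Sum>j<module_rank X. h i (b j) * (k * v j))"
      using 4 by (simp add: U_def h_smult sum_distrib_left ac_simps)
    moreover have "k \<odot>\<^bsub>?V\<^esub> C \<in> carrier ?V" using 4 V.smult_closed[of k C] by (simp add: U_def)
    ultimately show ?case unfolding U_def by (auto intro!: exI[of _ "\<lambda>j. k * v j"])
  qed
  moreover have "A \<subseteq> U"
  proof
    fix C assume C: "C \<in> A"
    then obtain l where l: "l < module_rank X" "C = b l"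
      using b by (auto simp: bij_betw_def)
    then have "\<forall>i. h i C = (\<Sum>j<module_rank X. h i (b j) * of_bool (j = l))"
      by (simp add: of_bool_def if_distrib sum.delta cong: if_cong)
    then show "C \<in> U"
      using C A(3) unfolding U_def by (auto intro!: exI[of _ "\<lambda>j. of_bool (j = l)"])
  qed
  ultimately have "carrier ?V \<subseteq> U" using V.span_is_subset A(4) by metis
  then have "\<exists>w. \<forall>i. f i x = (\<Sum>j<module_rank X. h i (b j) * w j)" if "x \<in> carrier X" for x
  proof -
    have "pure_tensor X 1 x \<in> U" using \<open>carrier ?V \<subseteq> U\<close> pure_tensor_closed[OF that] by blast
    then show ?thesis unfolding U_def mem_Collect_eq h_pure[OF that] by (rule conjunct2)
  qed
  then show thesis by (rule that)
qed

end

section \<open>Cramer's rule for factored matrices\<close>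

text \<open>
  The matrix \<open>D\<close> is \<open>d\<close> times the inverse of the rows \<open>r\<close> of \<open>P W\<close>. So multiplication by \<open>P W D\<close>
  recovers, up to \<open>d\<close>, a vector in the column space of \<open>P\<close> from its entries in the rows \<open>r\<close>.
\<close>

lemma smult_factored_vec:
  fixes P W D :: "'k::field mat"
  assumes P: "P \<in> carrier_mat m k" and W: "W \<in> carrier_mat k k" and D: "D \<in> carrier_mat k k"
    and w: "w \<in> carrier_vec k"
    and r: "\<And>i. i < k \<Longrightarrow> r i < m"
    and inv: "mat k k (\<lambda>(i, j). (P * W) $$ (r i, j)) * D = d \<cdot>\<^sub>m 1\<^sub>m k" and d: "d \<noteq> 0"
  shows "d \<cdot>\<^sub>v (P *\<^sub>v w) = (P * W) *\<^sub>v (D *\<^sub>v vec k (\<lambda>i. (P *\<^sub>v w) $ r i))"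
proof -
  define Q where "Q = mat k k (\<lambda>(i, j). P $$ (r i, j))"
  have Q: "Q \<in> carrier_mat k k" by (simp add: Q_def)
  have row: "row Q i = row P (r i)" if "i < k" for i
    using that r P by (auto simp: Q_def intro!: eq_vecI)
  have "mat k k (\<lambda>(i, j). (P * W) $$ (r i, j)) = Q * W"
    using P W Q r by (intro eq_matI) (auto simp: row)
  then have "Q * (W * D) = d \<cdot>\<^sub>m 1\<^sub>m k"
    using inv Q W D by (simp add: assoc_mult_mat[OF Q W D])
  then have "Q * (inverse d \<cdot>\<^sub>m (W * D)) = 1\<^sub>m k"
    using d W D mult_smult_distrib[OF Q mult_carrier_mat[OF W D], of "inverse d"]
    by (auto intro!: eq_matI)
  then have "(inverse d \<cdot>\<^sub>m (W * D)) * Q = 1\<^sub>m k"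
    using Q W D by (intro mat_mult_left_right_inverse[of Q]) auto
  then have "inverse d \<cdot>\<^sub>m ((W * D) * Q) = 1\<^sub>m k"
    using mult_smult_assoc_mat[OF mult_carrier_mat[OF W D] Q, of "inverse d"] by simp
  then have "d \<cdot>\<^sub>m (inverse d \<cdot>\<^sub>m ((W * D) * Q)) = d \<cdot>\<^sub>m 1\<^sub>m k" by simp
  moreover have "d \<cdot>\<^sub>m (inverse d \<cdot>\<^sub>m ((W * D) * Q)) = (W * D) * Q"
    using d by (intro eq_matI) (auto simp: mult.assoc[symmetric])
  ultimately have WDQ: "(W * D) * Q = d \<cdot>\<^sub>m 1\<^sub>m k" by simp
  \<comment> \<open>The inverse relation on the other side is the point of the proof: it cancels \<open>Q\<close> against \<open>W D\<close>.\<close>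
  have "vec k (\<lambda>i. (P *\<^sub>v w) $ r i) = Q *\<^sub>v w"
    using P Q r by (intro eq_vecI) (auto simp: row)
  then have "(P * W) *\<^sub>v (D *\<^sub>v vec k (\<lambda>i. (P *\<^sub>v w) $ r i)) = P *\<^sub>v (((W * D) * Q) *\<^sub>v w)"
    using P Q W D w by (simp add: assoc_mult_mat_vec[of W k k "D * Q" k w] assoc_mult_mat_vec[of D k k Q k w])
  also have "((W * D) * Q) *\<^sub>v w = d \<cdot>\<^sub>v w"
    unfolding WDQ using w by (intro eq_vecI) auto
  finally show ?thesis using mult_mat_vec[OF P w] by simp
qed

text \<open>
  The factorization exists only over the fraction field, but both sides of the resulting identity
  have entries in the domain when the adjugate of \<open>B\<close> takes the place of \<open>D\<close>.
\<close>

lemma minor_smult_eq_column_combination: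
  fixes C :: "'a::idom mat" and P W :: "'a fract mat"
  assumes C: "C \<in> carrier_mat m k" and x: "x \<in> carrier_vec m"
    and r: "\<And>i. i < k \<Longrightarrow> r i < m"
    and P: "P \<in> carrier_mat m k" and W: "W \<in> carrier_mat k k" and w: "w \<in> carrier_vec k"
    and C_eq: "map_mat to_fract C = P * W" and x_eq: "map_vec to_fract x = P *\<^sub>v w"
    and B: "B = mat k k (\<lambda>(i, j). C $$ (r i, j))" and det: "det B \<noteq> 0"
  shows "det B \<cdot>\<^sub>v x = C *\<^sub>v (adj_mat B *\<^sub>v vec k (\<lambda>i. x $ r i))"
proof -
  interpret inj_comm_ring_hom "to_fract :: 'a \<Rightarrow> 'a fract"
    by unfold_locales auto
  have Bc: "B \<in> carrier_mat k k" by (simp add: B)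
  have B': "map_mat to_fract B = mat k k (\<lambda>(i, j). (P * W) $$ (r i, j))"
    unfolding C_eq[symmetric] B using C r by (intro eq_matI) auto
  have inv: "map_mat to_fract B * map_mat to_fract (adj_mat B) = to_fract (det B) \<cdot>\<^sub>m 1\<^sub>m k"
    unfolding mat_hom_mult[OF Bc adj_mat(1)[OF Bc], symmetric] adj_mat(2)[OF Bc]
    by (intro eq_matI) auto
  have rows: "vec k (\<lambda>i. (P *\<^sub>v w) $ r i) = map_vec to_fract (vec k (\<lambda>i. x $ r i))"
    unfolding x_eq[symmetric] using x r by (intro eq_vecI) auto
  have "map_vec to_fract (det B \<cdot>\<^sub>v x) = to_fract (det B) \<cdot>\<^sub>v (P *\<^sub>v w)"
    unfolding vec_hom_smult x_eq ..
  also have "\<dots> = (P * W) *\<^sub>v (map_mat to_fract (adj_mat B) *\<^sub>v vec k (\<lambda>i. (P *\<^sub>v w) $ r i))"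
    using adj_mat(1)[OF Bc] inv det unfolding B'
    by (intro smult_factored_vec[OF P W _ w r]) auto
  also have "\<dots> = map_vec to_fract (C *\<^sub>v (adj_mat B *\<^sub>v vec k (\<lambda>i. x $ r i)))"
    unfolding rows C_eq[symmetric]
    using mult_mat_vec_hom[OF adj_mat(1)[OF Bc], of "vec k (\<lambda>i. x $ r i)"]
      mult_mat_vec_hom[OF C, of "adj_mat B *\<^sub>v vec k (\<lambda>i. x $ r i)"] adj_mat(1)[OF Bc]
    by simp
  finally show ?thesis by (rule vec_hom_inj)
qed

section \<open>Minors and colon ideals\<close>

lemma mult_mat_vec_in_submodule:
  fixes C :: "'a::idom mat"
  assumes M: "LinearCombinations.submodule class_ring M (module_vec TYPE('a) m)"
    and C: "C \<in> carrier_mat m k" and u: "u \<in> carrier_vec k"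
    and cols: "set (cols C) \<subseteq> M"
  shows "C *\<^sub>v u \<in> M"
proof -
  interpret V: vec_module "TYPE('a)" m .
  have set_cols: "set (cols C) \<subseteq> carrier_vec m" using cols_dim[of C] C by simp
  have C_eq: "mat_of_cols m (cols C) = C" using C mat_of_cols_cols[of C] by simp
  have "C *\<^sub>v u \<in> V.span (set (cols C))"
    using V.mat_of_cols_mult_as_finsum[of u "cols C"] C u set_cols
    unfolding C_eq V.span_def by (auto simp: subset_iff)
  then show ?thesis using V.span_is_subset[OF cols M] by blast
qed

lemma colon_ideal:
  fixes M N :: "'a::idom vec set"
  assumes M: "LinearCombinations.submodule class_ring M (module_vec TYPE('a) m)"
    and N: "N \<subseteq> carrier_vec m"
  shows "ideal (colon M N) class_ring"
proof -
  interpret M: LinearCombinations.submodule class_ring M "module_vec TYPE('a) m" by (rule M)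
  have add: "v + w \<in> M" if "v \<in> M" "w \<in> M" for v w
    using M.m_closed[OF that] by (simp add: module_vec_simps)
  have smult: "a \<cdot>\<^sub>v v \<in> M" if "v \<in> M" for a v
    using M.smult_closed[of a v] that by (simp add: module_vec_simps)
  have zero: "0\<^sub>v m \<in> M"
    using M.zero_closed by (simp add: module_vec_simps)
  have mult: "b * a \<in> colon M N" if "a \<in> colon M N" for a b
    using that smult[of _ b] by (auto simp: colon_def smult_smult_assoc[symmetric])
  have uminus: "- a \<in> colon M N" if "a \<in> colon M N" for a
    using mult[OF that, of "-1"] by simp
  have "subgroup (colon M N) (add_monoid class_ring)"
  proof (rule subgroup.intro, goal_cases)
    case (2 a b)
    then show ?case using add by (auto simp: colon_def add_smult_distrib_vec)
  next
    case 3
    have "0 \<cdot>\<^sub>v x = 0\<^sub>v m" if "x \<in> N" for x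
      using that N by (intro eq_vecI) auto
    then show ?case using zero by (simp add: colon_def)
  next
    case (4 a)
    moreover have "inv\<^bsub>add_monoid class_ring\<^esub> a = - a"
      using a_inv_def[of "class_ring :: 'a ring"] unfolding class_ring_simps by metis
    ultimately show ?case using uminus by simp
  qed simp
  then show ?thesis
    by (intro idealI class_ring.ring_axioms)
      (use mult in \<open>auto simp: mult.commute\<close>)
qed

text \<open>
  The coordinates of \<open>R\<^sup>m\<close>, restricted to \<open>N\<close>, factor through the rank of \<open>N\<close>; the coefficients
  of this factorization are the entries of \<open>P\<close>.
\<close>

lemma rank_factorization:
  fixes N :: "'a::idom vec set"
  assumes N: "fg_submodule m N"
  obtains P :: "'a fract mat" where "P \<in> carrier_mat m (submodule_rank m N)"
    "\<And>x. x \<in> N \<Longrightarrow> \<exists>w \<in> carrier_vec (submodule_rank m N). map_vec to_fract x = P *\<^sub>v w"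
proof -
  interpret V: vec_module "TYPE('a)" m .
  let ?g = "submodule_rank m N"
  define X where "X = (module_vec TYPE('a) m)\<lparr>carrier := N\<rparr>"
  from N obtain S where sub: "LinearCombinations.submodule class_ring N (module_vec TYPE('a) m)"
    and S: "finite S" "S \<subseteq> N" "V.span S = N"
    by (auto simp: fg_submodule_def)
  have N_carrier: "N \<subseteq> carrier_vec m"
    using LinearCombinations.submodule.subset[OF sub] by (simp add: module_vec_simps)
  have X: "Module.module class_ring X"
    unfolding X_def by (rule V.submodule_is_module[OF sub])
  have X_simps: "carrier X = N" "add X = (+)" "smult X = (\<cdot>\<^sub>v)" "module_rank X = ?g"
    by (simp_all add: X_def module_vec_simps submodule_rank_def)
  have span_X: "LinearCombinations.module.span class_ring X S = carrier X"
    unfolding X_simps using V.span_li_not_depend(1)[OF S(2) sub] S(3) by (simp add: X_def)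
  \<comment> \<open>An entry beyond the dimension is unspecified and need not be additive, hence the value \<open>0\<close> there.\<close>
  let ?f = "\<lambda>i x. if i < m then to_fract (x $ i) else 0"
  have "\<exists>p :: nat \<Rightarrow> nat \<Rightarrow> 'a fract. \<forall>x\<in>N. \<exists>w. \<forall>i. ?f i x = (\<Sum>j<?g. p i j * w j)"
  proof (rule functionals_factor_through_rank[OF X S(1) _ span_X, of ?f, unfolded X_simps])
    show "?f i (x + y) = ?f i x + ?f i y" if "x \<in> N" "y \<in> N" for i x y
      using that N_carrier by (auto simp: subset_iff)
    show "?f i (r \<cdot>\<^sub>v x) = Fract r 1 * ?f i x" if "x \<in> N" for i r x
      using that N_carrier by (auto simp: subset_iff to_fract_def)
  qed (use S(2) in blast)+
  then obtain p :: "nat \<Rightarrow> nat \<Rightarrow> 'a fract" where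
    p: "\<And>x. x \<in> N \<Longrightarrow> \<exists>w. \<forall>i. ?f i x = (\<Sum>j<?g. p i j * w j)" by blast
  show thesis
  proof (rule that[of "mat m ?g (\<lambda>(i, j). p i j)"])
    fix x assume x: "x \<in> N"
    from p[OF x] obtain w where
      w: "\<And>i. (if i < m then to_fract (x $ i) else 0) = (\<Sum>j<?g. p i j * w j)" by blast
    have "map_vec to_fract x = mat m ?g (\<lambda>(i, j). p i j) *\<^sub>v vec ?g w"
    proof (rule eq_vecI)
      fix i assume "i < dim_vec (mat m ?g (\<lambda>(i, j). p i j) *\<^sub>v vec ?g w)"
      then have i: "i < m" by simp
      then show "map_vec to_fract x $ i = (mat m ?g (\<lambda>(i, j). p i j) *\<^sub>v vec ?g w) $ i"
        using w[of i] x N_carrier by (auto simp: scalar_prod_def atLeast0LessThan)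
    qed (use x N_carrier in auto)
    then show "\<exists>w\<in>carrier_vec ?g. map_vec to_fract x = mat m ?g (\<lambda>(i, j). p i j) *\<^sub>v w"
      by (intro bexI[of _ "vec ?g w"]) auto
  qed auto
qed

text \<open>
  The hypothesis on \<open>P\<close> says that \<open>N\<close> has rank at most \<open>k\<close>. As \<open>M \<subseteq> N\<close>, it factors both the columns
  of \<open>A\<close> that occur in the minor and the elements of \<open>N\<close>, which is what Cramer's rule asks for.
\<close>

lemma minor_mem_colon:
  fixes M N :: "'a::idom vec set" and P :: "'a fract mat"
  assumes M: "LinearCombinations.submodule class_ring M (module_vec TYPE('a) m)"
    and "M \<subseteq> N" and N: "N \<subseteq> carrier_vec m"
    and A: "A \<in> carrier_mat m n" and cols: "set (cols A) \<subseteq> M"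
    and P: "P \<in> carrier_mat m k"
    and factor: "\<And>x. x \<in> N \<Longrightarrow> \<exists>w \<in> carrier_vec k. map_vec to_fract x = P *\<^sub>v w"
    and minor: "\<delta> \<in> minors k A"
  shows "\<delta> \<in> colon M N"
proof -
  from minor A obtain I J where IJ: "I \<subseteq> {..<m}" "J \<subseteq> {..<n}" "card I = k" "card J = k"
    and \<delta>: "\<delta> = det (submatrix A I J)"
    by (auto simp: minors_def)
  have eqs: "{i. i < m \<and> i \<in> I} = I" "{j. j < n \<and> j \<in> J} = J" using IJ by auto
  have pick_I: "pick I i < m" and pick_J: "pick J i < n" if "i < k" for i
    using pick_le[of i m I] pick_le[of i n J] that IJ eqs by simp_all
  define C where "C = mat m k (\<lambda>(i, j). A $$ (i, pick J j))"
  have C: "C \<in> carrier_mat m k" by (simp add: C_def)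
  have col_C: "col C j = col A (pick J j)" if "j < k" for j
    using that A pick_J by (intro eq_vecI) (auto simp: C_def)
  have cols_C: "col C j \<in> M" if "j < k" for j
    using that A pick_J cols col_C by (auto simp: cols_def)
  have B: "submatrix A I J = mat k k (\<lambda>(i, j). C $$ (pick I i, j))"
    using A IJ eqs pick_I by (intro eq_matI) (auto simp: submatrix_def C_def)
  have "\<exists>v. v \<in> carrier_vec k \<and> (j < k \<longrightarrow> map_vec to_fract (col C j) = P *\<^sub>v v)" for j
    using factor[of "col C j"] cols_C \<open>M \<subseteq> N\<close> by (cases "j < k") (auto intro: exI[of _ "0\<^sub>v k"])
  then obtain v where v: "\<And>j. v j \<in> carrier_vec k"
    "\<And>j. j < k \<Longrightarrow> map_vec to_fract (col C j) = P *\<^sub>v v j" by metis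
  define W where "W = mat_of_cols k (map v [0..<k])"
  have W: "W \<in> carrier_mat k k" by (simp add: W_def carrier_matI)
  have col_W: "col W j = v j" if "j < k" for j
    unfolding W_def using v(1) that by (subst col_mat_of_cols) auto
  have C_eq: "map_mat to_fract C = P * W"
  proof (rule eq_matI)
    fix i j assume "i < dim_row (P * W)" "j < dim_col (P * W)"
    then have ij: "i < m" "j < k" using P W by auto
    have "to_fract (C $$ (i, j)) = map_vec to_fract (col C j) $ i" using ij C by simp
    also have "\<dots> = (P * W) $$ (i, j)" using ij P W by (simp add: v(2) col_W)
    finally show "map_mat to_fract C $$ (i, j) = (P * W) $$ (i, j)" using ij C by simp
  qed (use C P W in auto)
  have "\<delta> \<cdot>\<^sub>v x \<in> M" if x: "x \<in> N" for x
  proof (cases "\<delta> = 0")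
    case True
    have "0\<^sub>v m \<in> M"
      using LinearCombinations.submodule.zero_closed[OF M] by (simp add: module_vec_simps)
    moreover have "\<delta> \<cdot>\<^sub>v x = 0\<^sub>v m" using True x N by (intro eq_vecI) auto
    ultimately show ?thesis by simp
  next
    case False
    from factor[OF x] obtain w where w: "w \<in> carrier_vec k" "map_vec to_fract x = P *\<^sub>v w" by blast
    let ?B = "submatrix A I J"
    have "\<delta> \<cdot>\<^sub>v x = C *\<^sub>v (adj_mat ?B *\<^sub>v vec k (\<lambda>i. x $ pick I i))"
      using False x N unfolding \<delta>
      by (intro minor_smult_eq_column_combination[OF C _ pick_I P W w(1) C_eq w(2) B]) auto
    moreover have "adj_mat ?B \<in> carrier_mat k k"
      by (rule adj_mat(1)) (simp add: B)
    then have "C *\<^sub>v (adj_mat ?B *\<^sub>v vec k (\<lambda>i. x $ pick I i)) \<in> M"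
      using cols_C C by (intro mult_mat_vec_in_submodule[OF M C]) (auto simp: cols_def)
    ultimately show ?thesis by simp
  qed
  then show ?thesis by (simp add: colon_def)
qed

theorem lemma1p3:
  fixes m g :: nat and M N :: "'a::idom vec set" and I :: "'a set"
  assumes "fg_submodule m M" and "fg_submodule m N" and "M \<subseteq> N"
    and "submodule_rank m M = g" and "submodule_rank m N = g"
    and "is_fitting_ideal m (m - g) M I"
  shows "I \<subseteq> colon M N"
proof -
  interpret V: vec_module "TYPE('a)" m .
  have M: "LinearCombinations.submodule class_ring M (module_vec TYPE('a) m)"
    and N: "N \<subseteq> carrier_vec m"
    using assms(1,2) LinearCombinations.submodule.subset[of class_ring N "module_vec TYPE('a) m"]
    by (auto simp: fg_submodule_def module_vec_simps)
  from assms(6) obtain n A where A: "A \<in> carrier_mat m n" and span: "V.span (set (cols A)) = M"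
    and I: "I = Idl\<^bsub>class_ring\<^esub> (minors (m - (m - g)) A)"
    by (auto simp: is_fitting_ideal_def)
  have cols: "set (cols A) \<subseteq> M"
    using V.in_own_span[of "set (cols A)"] cols_dim[of A] A span by simp
  \<comment> \<open>The minors have size \<open>min g m\<close>. If this is \<open>m\<close>, the identity matrix factors all of \<open>R\<^sup>m\<close>.\<close>
  obtain P :: "'a fract mat" where P: "P \<in> carrier_mat m (m - (m - g))"
    "\<And>x. x \<in> N \<Longrightarrow> \<exists>w \<in> carrier_vec (m - (m - g)). map_vec to_fract x = P *\<^sub>v w"
  proof (cases "g \<le> m")
    case True
    then show thesis using rank_factorization[OF assms(2)] assms(5) that by auto
  next
    case False
    then show thesis
      using N by (intro that[of "1\<^sub>m m"]) (auto intro!: bexI[of _ "map_vec to_fract _"])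
  qed
  have "minors (m - (m - g)) A \<subseteq> colon M N"
    using minor_mem_colon[OF M assms(3) N A cols P] by blast
  then show ?thesis
    unfolding I by (rule ring.genideal_minimal[OF class_ring.ring_axioms colon_ideal[OF M N]])
qed

end
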